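(* Let $A\in\mathbb{R}^{m\times d}$ and $b\in\mathbb{R}^m$, let $(v^k)_k$ be generated by the random descent (RD) iteration (described in the context), and assume that the matrix $$M:=\mathbb{E}\left(\frac{xx^T}{\|Ax\|^2}\right)\in\mathbb{R}^{d\times d}$$ exists. Then the following hold. 1. For the expectation with respect to the choice of $x$ in the $k$th step we have $$\mathbb{E}\big(\|Av^{k+1}-b\|^2\big)=\|Av^k-b\|^2-\left\langle A^T(Av^k-b),\,M A^T(Av^k-b)\right\rangle .$$ 2. If $\lambda_{\min}(M)>0$, it holds that $$\min_{0\le k\le N-1}\mathbb{E}\big(\|A^T(Av^k-b)\|^2\big)\le\frac{\|b\|^2}{\lambda_{\min}(M)\,N}.$$ 3. It holds that $$\mathbb{E}\big(\|Av^{k+1}-b\|^2\big)\le\left(1-\lambda_{\min}(M)\,\sigma_{\min}(A)^2\right)\mathbb{E}\big(\|Av^k-b\|^2\big)$$ and $$\mathbb{E}\big(\|Av^{k+1}-b\|^2\big)\le\left(1-\lambda_{\min}(AMA^T)\right)\mathbb{E}\big(\|Av^k-b\|^2\big).$$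
   Context: $\|\cdot\|$ is the Euclidean norm; $\lambda_{\min}$ is the smallest eigenvalue of a real symmetric matrix; $\sigma_{\min}(A)$ is the smallest positive singular value of $A$. Random descent (RD): $v^0=0\in\mathbb{R}^d$ and, for $k=0,1,2,\dots$, draw a fresh random vector $x\in\mathbb{R}^d$ (with the distribution used in the definition of $M$) and set $v^{k+1}=v^k+\tau_kx$, where $\tau_k$ minimizes $\tau\mapsto\tfrac12\|A(v^k+\tau x)-b\|^2$, i.e. $\tau_k=-\langle Av^k-b,Ax\rangle/\|Ax\|^2$ if $Ax\ne0$ and $\tau_k=0$ if $Ax=0$. "$M$ exists" means that the expectation defining $M$ exists. In items 2 and 3, $\mathbb{E}$ is the expectation over all involved randomness.
   Formalization: The first inequality of item 3 is stated only for b in the range of A; without this it is false, e.g. for A=(1,0)^T, b=(0,1)^T, x=1, where it would read 1 ≤ 0. *)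

theory Defs
  imports "HOL-Probability.Probability"
begin

definition eigenvalue :: "real^'n^'n \<Rightarrow> real \<Rightarrow> bool" where
  "eigenvalue S l \<longleftrightarrow> (\<exists>u. u \<noteq> 0 \<and> S *v u = l *\<^sub>R u)"

definition singular_value :: "real^'d^'m \<Rightarrow> real \<Rightarrow> bool" where
  "singular_value A s \<longleftrightarrow> s \<ge> 0 \<and> eigenvalue (transpose A ** A) (s\<^sup>2)"

definition lambda_min :: "real^'n^'n \<Rightarrow> real" where
  "lambda_min S = (LEAST l. eigenvalue S l)"

text \<open>The smallest \<^emph>\<open>positive\<close> singular value, so that
  \<open>norm (transpose A *v r) \<ge> sigma_min A * norm r\<close> holds for \<open>r\<close> in the range of \<open>A\<close>, but not for
  every \<open>r\<close>.  The value is unspecified for \<open>A = 0\<close>.\<close>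

definition sigma_min :: "real^'d^'m \<Rightarrow> real" where
  "sigma_min A = (LEAST s. s > 0 \<and> singular_value A s)"

text \<open>The exact line search: for \<open>A *v x \<noteq> 0\<close>, the minimizer of
  \<open>t \<mapsto> (norm (A *v (v + t *\<^sub>R x) - b))\<^sup>2 / 2\<close>.\<close>

definition rd_stepsize :: "real^'d^'m \<Rightarrow> real^'m \<Rightarrow> real^'d \<Rightarrow> real^'d \<Rightarrow> real" where
  "rd_stepsize A b v x =
     (if A *v x \<noteq> 0 then - ((A *v v - b) \<bullet> (A *v x)) / (norm (A *v x))\<^sup>2 else 0)"

text \<open>\<open>rd_iter A b xs k\<close> is the iterate \<open>v\<^sup>k\<close> of random descent as a function of the sequence \<open>xs\<close> of
  drawn directions; \<open>xs k\<close> is the direction used to pass from \<open>v\<^sup>k\<close> to the next iterate.\<close>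

primrec rd_iter :: "real^'d^'m \<Rightarrow> real^'m \<Rightarrow> (nat \<Rightarrow> real^'d) \<Rightarrow> nat \<Rightarrow> real^'d" where
  "rd_iter A b xs 0 = 0"
| "rd_iter A b xs (Suc k) =
     rd_iter A b xs k + rd_stepsize A b (rd_iter A b xs k) (xs k) *\<^sub>R xs k"

text \<open>The matrix \<open>x x\<^sup>T / \<parallel>A x\<parallel>\<^sup>2\<close>.  By \<open>a / 0 = 0\<close> it is \<open>0\<close> if \<open>A *v x = 0\<close>, in agreement with the
  vanishing step size in that case.\<close>

definition rd_rank_one :: "real^'d^'m \<Rightarrow> real^'d \<Rightarrow> real^'d^'d" where
  "rd_rank_one A x = (\<chi> i j. x $ i * x $ j / (norm (A *v x))\<^sup>2)"

definition rd_matrix :: "real^'d^'m \<Rightarrow> (real^'d) measure \<Rightarrow> real^'d^'d" where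
  "rd_matrix A D = (LINT x|D. rd_rank_one A x)"

end

theory Submission
  imports Defs
begin

text \<open>Let \<open>r\<close> be the residual \<open>A *v v - b\<close> at an iterate \<open>v\<close> and let \<open>g = transpose A *v r\<close> be the
  gradient there. Exact line search along \<open>x\<close> subtracts from \<open>r\<close> its orthogonal projection onto
  the line spanned by \<open>A *v x\<close>, so for every single direction the squared residual drops by
  exactly \<open>g \<bullet> (rd_rank_one A x *v g)\<close> (\<open>norm_residual_after_step\<close>). This is linear in the matrix;
  averaging over \<open>x\<close> replaces the matrix by \<open>M\<close> and gives the one-step identity.

  The iterate \<open>v k\<close> depends only on the directions drawn before step \<open>k\<close>. It is therefore
  independent of \<open>X k\<close>, and the same replacement is allowed in the total expectation
  (\<open>expectation_residual_Suc\<close>). No step increases the residual, so residuals and gradients are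
  uniformly bounded; this makes all expectations involved finite.

  The rest is a matter of lower bounds for \<open>g \<bullet> (M *v g)\<close>, where \<open>M\<close> is symmetric and positive
  semidefinite. It is at least \<open>lambda_min M * (norm g)\<^sup>2\<close>; telescoping over the steps bounds the
  average, hence the minimum, of the expected squared gradients. If \<open>b\<close> lies in the range of \<open>A\<close>,
  then so does \<open>r\<close>, and \<open>norm g\<close> is at least \<open>sigma_min A * norm r\<close>; this gives the first linear
  rate. Finally \<open>g \<bullet> (M *v g) = r \<bullet> (A ** M ** transpose A *v r)\<close>, which gives the second one.

  Eigenvalues enter only through the variational principle that the minimum of the Rayleigh
  quotient on an invariant subspace is an eigenvalue
  (\<open>rayleigh_minimum_on_invariant_subspace\<close>). It is applied to the whole space for \<open>lambda_min\<close> and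
  to the range of \<open>A\<close> for \<open>sigma_min\<close>.\<close>

section \<open>Rayleigh quotients and smallest eigenvalues\<close>

(* Otherwise the simplifier turns transpose A *v x into x v* A. *)
declare transpose_matrix_vector [simp del]

lemma inner_transpose_mult_left:
  fixes A :: "real^'d^'m"
  shows "(transpose A *v r) \<bullet> x = r \<bullet> (A *v x)"
  by (simp add: transpose_matrix_vector dot_lmul_matrix)

lemma inner_symmetric_mult:
  fixes S :: "real^'n^'n"
  assumes "transpose S = S"
  shows "(S *v x) \<bullet> y = x \<bullet> (S *v y)"
  using inner_transpose_mult_left[of S x y] assms by simp

text \<open>Taking \<open>t\<close> small and of sign opposite to \<open>a\<close>, the linear term would dominate.\<close>

lemma linear_coefficient_eq_0_if_quadratic_nonneg:
  fixes a c :: real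
  assumes "\<And>t. 0 \<le> 2 * t * a + t\<^sup>2 * c"
  shows "a = 0"
proof (rule ccontr)
  assume "a \<noteq> 0"
  define k where "k = \<bar>c\<bar> + 1"
  have k: "k > 0" "c < k" "k \<noteq> 0" unfolding k_def by auto
  \<comment> \<open>\<open>- a / k\<close> minimizes \<open>2 * t * a + t\<^sup>2 * k\<close>, which bounds the given quadratic from above.\<close>
  have "0 \<le> 2 * (- a / k) * a + (- a / k)\<^sup>2 * c"
    by (rule assms)
  also have "\<dots> = a\<^sup>2 * (c - 2 * k) / k\<^sup>2"
    using k by (simp add: field_simps power2_eq_square)
  also have "\<dots> < 0"
    using k \<open>a \<noteq> 0\<close> by (intro divide_neg_pos mult_pos_neg) auto
  finally show False by simp
qed

text \<open>The minimum of the Rayleigh quotient over the unit sphere of an invariant subspace \<open>V\<close> is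
  attained by compactness. Perturbing the minimizer \<open>u\<close> in the direction of its residual
  \<open>S *v u - q *\<^sub>R u\<close>, which lies in \<open>V\<close> by invariance, the first-order condition says that
  this residual is orthogonal to itself; so \<open>u\<close> is an eigenvector.\<close>

lemma rayleigh_minimum_on_invariant_subspace:
  fixes S :: "real^'n^'n"
  assumes sym: "transpose S = S" and V: "subspace V" and inv: "\<And>x. x \<in> V \<Longrightarrow> S *v x \<in> V"
    and nontriv: "\<exists>x\<in>V. x \<noteq> 0"
  obtains q u where "u \<in> V" "norm u = 1" "S *v u = q *\<^sub>R u"
    "\<And>x. x \<in> V \<Longrightarrow> q * (norm x)\<^sup>2 \<le> x \<bullet> (S *v x)"
proof -
  let ?K = "V \<inter> sphere 0 1"
  obtain y where y: "y \<in> V" "y \<noteq> 0" using nontriv by blast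
  have "(1 / norm y) *\<^sub>R y \<in> ?K"
    using y V by (auto intro: subspace_scale)
  then have "?K \<noteq> {}" by blast
  moreover have "compact ?K"
    by (intro closed_Int_compact closed_subspace V compact_sphere)
  moreover have "continuous_on ?K (\<lambda>x. x \<bullet> (S *v x))"
    by (intro continuous_intros linear_continuous_on matrix_vector_mul_bounded_linear)
  ultimately obtain u where u: "u \<in> ?K" and min: "\<And>x. x \<in> ?K \<Longrightarrow> u \<bullet> (S *v u) \<le> x \<bullet> (S *v x)"
    using continuous_attains_inf[of ?K "\<lambda>x. x \<bullet> (S *v x)"] by blast
  define q where "q = u \<bullet> (S *v u)"
  have uV: "u \<in> V" and nu: "norm u = 1" using u by auto
  have ray: "q * (norm x)\<^sup>2 \<le> x \<bullet> (S *v x)" if "x \<in> V" for x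
  proof (cases "x = 0")
    case False
    then have "(1 / norm x) *\<^sub>R x \<in> ?K"
      using that V by (auto intro: subspace_scale)
    from min[OF this] have "q \<le> (x \<bullet> (S *v x)) / (norm x)\<^sup>2"
      by (simp add: q_def matrix_vector_mult_scaleR power2_eq_square)
    then show ?thesis using False by (simp add: field_simps)
  qed simp
  define w where "w = S *v u - q *\<^sub>R u"
  have wV: "w \<in> V"
    unfolding w_def by (intro subspace_diff subspace_scale inv uV V)
  have "w \<bullet> w = 0"
  proof (rule linear_coefficient_eq_0_if_quadratic_nonneg)
    fix t :: real
    have uu: "u \<bullet> u = 1" using nu by (simp add: dot_square_norm)
    have "q * (norm (u + t *\<^sub>R w))\<^sup>2 \<le> (u + t *\<^sub>R w) \<bullet> (S *v (u + t *\<^sub>R w))"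
      by (intro ray subspace_add subspace_scale uV wV V)
    also have "\<dots> = q + 2 * t * ((S *v u) \<bullet> w) + t\<^sup>2 * (w \<bullet> (S *v w))"
      using inner_symmetric_mult[OF sym, of u w]
      by (simp add: q_def matrix_vector_mult_scaleR matrix_vector_right_distrib inner_add_left
          inner_add_right inner_commute algebra_simps power2_eq_square)
    finally have "q * (norm (u + t *\<^sub>R w))\<^sup>2
        \<le> q + 2 * t * ((S *v u) \<bullet> w) + t\<^sup>2 * (w \<bullet> (S *v w))" .
    moreover have "(norm (u + t *\<^sub>R w))\<^sup>2 = 1 + 2 * t * (u \<bullet> w) + t\<^sup>2 * (w \<bullet> w)"
      unfolding power2_norm_eq_inner
      using uu by (simp add: inner_add_left inner_add_right inner_commute
          algebra_simps power2_eq_square)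
    moreover have "(S *v u) \<bullet> w = w \<bullet> w + q * (u \<bullet> w)"
      by (simp add: w_def inner_diff_left flip: inner_add_left inner_scaleR_left)
    ultimately have "q * (1 + 2 * t * (u \<bullet> w) + t\<^sup>2 * (w \<bullet> w))
        \<le> q + 2 * t * (w \<bullet> w + q * (u \<bullet> w)) + t\<^sup>2 * (w \<bullet> (S *v w))"
      by simp
    then show "0 \<le> 2 * t * (w \<bullet> w) + t\<^sup>2 * (w \<bullet> (S *v w) - q * (w \<bullet> w))"
      by (simp add: algebra_simps)
  qed
  then have "S *v u = q *\<^sub>R u" by (simp add: w_def)
  with that uV nu ray show ?thesis by blast
qed

text \<open>The case where the subspace is the whole space: the Rayleigh minimum is an eigenvalue, and
  it bounds every other eigenvalue from below.\<close>

lemma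
  fixes S :: "real^'n^'n"
  assumes sym: "transpose S = S"
  shows eigenvalue_lambda_min: "eigenvalue S (lambda_min S)"
    and lambda_min_le_rayleigh: "lambda_min S * (norm x)\<^sup>2 \<le> x \<bullet> (S *v x)"
proof -
  obtain q u where u: "norm u = 1" "S *v u = q *\<^sub>R u"
    and ray: "\<And>x. q * (norm x)\<^sup>2 \<le> x \<bullet> (S *v x)"
  proof (rule rayleigh_minimum_on_invariant_subspace[OF sym, of UNIV])
    show "\<exists>x\<in>UNIV. x \<noteq> (0::real^'n)"
      by (rule bexI[of _ "axis undefined 1"]) (auto simp: axis_eq_0_iff)
  qed auto
  have q: "eigenvalue S q"
    unfolding eigenvalue_def using u by (intro exI[of _ u]) auto
  have "lambda_min S = q"
    unfolding lambda_min_def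
  proof (rule Least_equality[of "eigenvalue S", OF q])
    fix l assume "eigenvalue S l"
    then obtain y where y: "y \<noteq> 0" "S *v y = l *\<^sub>R y" unfolding eigenvalue_def by blast
    have "q * (norm y)\<^sup>2 \<le> l * (norm y)\<^sup>2"
      using ray[of y] y by (simp add: power2_norm_eq_inner)
    then show "q \<le> l" using y by simp
  qed
  then show "eigenvalue S (lambda_min S)" "lambda_min S * (norm x)\<^sup>2 \<le> x \<bullet> (S *v x)"
    using q ray by auto
qed

lemma lambda_min_nonneg:
  fixes S :: "real^'n^'n"
  assumes "transpose S = S" and psd: "\<And>x. 0 \<le> x \<bullet> (S *v x)"
  shows "0 \<le> lambda_min S"
proof -
  obtain u where "u \<noteq> 0" "S *v u = lambda_min S *\<^sub>R u"
    using eigenvalue_lambda_min[OF assms(1)] unfolding eigenvalue_def by blast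
  with psd[of u] have "0 \<le> lambda_min S * (u \<bullet> u)" "u \<bullet> u > 0"
    by simp_all
  then show ?thesis
    by (simp add: zero_le_mult_iff)
qed

text \<open>On the range of \<open>A\<close> the matrix \<open>A ** transpose A\<close> is positive definite, so its Rayleigh
  minimum there is a positive eigenvalue \<open>q\<close>. Since \<open>A\<close> and its transpose carry eigenvectors of
  \<open>transpose A ** A\<close> and of \<open>A ** transpose A\<close> into each other, with the same nonzero
  eigenvalues, the square root of \<open>q\<close> is the smallest positive singular value. If \<open>A = 0\<close>, then
  \<open>sigma_min A\<close> is unspecified, but \<open>r = 0\<close> and both sides vanish.\<close>

lemma sigma_min_le_norm_transpose_on_range:
  fixes A :: "real^'d^'m"
  assumes r: "r \<in> range (\<lambda>u. A *v u)"
  shows "(sigma_min A)\<^sup>2 * (norm r)\<^sup>2 \<le> (norm (transpose A *v r))\<^sup>2"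
proof (cases "r = 0")
  case False
  let ?V = "range (\<lambda>u. A *v u)" and ?S = "A ** transpose A"
  have quad: "x \<bullet> (?S *v x) = (norm (transpose A *v x))\<^sup>2" for x
    by (simp add: matrix_vector_mul_assoc[symmetric] power2_norm_eq_inner
        inner_transpose_mult_left)
  obtain q u where uV: "u \<in> ?V" and u: "norm u = 1" "?S *v u = q *\<^sub>R u"
    and ray: "\<And>x. x \<in> ?V \<Longrightarrow> q * (norm x)\<^sup>2 \<le> x \<bullet> (?S *v x)"
  proof (rule rayleigh_minimum_on_invariant_subspace[of ?S ?V])
    show "transpose ?S = ?S" by (simp add: matrix_transpose_mul)
    show "subspace ?V" by (intro linear_subspace_image subspace_UNIV) simp
    show "?S *v x \<in> ?V" for x by (auto simp: matrix_vector_mul_assoc[symmetric])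
    show "\<exists>x\<in>?V. x \<noteq> 0" using r False by blast
  qed (use that in blast)
  obtain z where z: "u = A *v z" using uV by blast
  have "u \<bullet> u = (transpose A *v u) \<bullet> z" by (simp add: inner_transpose_mult_left flip: z)
  then have Atu: "transpose A *v u \<noteq> 0" using u(1) by auto
  have "q = u \<bullet> (?S *v u)" using u by (simp add: dot_square_norm)
  also have "\<dots> > 0" using Atu by (simp add: quad)
  finally have q: "q > 0" .
  have "(transpose A ** A) *v (transpose A *v u) = q *\<^sub>R (transpose A *v u)"
    using u(2) by (metis matrix_vector_mul_assoc matrix_vector_mult_scaleR)
  then have sq: "singular_value A (sqrt q)"
    using Atu q unfolding singular_value_def eigenvalue_def by auto
  have "sigma_min A = sqrt q"
    unfolding sigma_min_def
  proof (rule Least_equality)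
    show "0 < sqrt q \<and> singular_value A (sqrt q)" using q sq by simp
    fix s assume s: "0 < s \<and> singular_value A s"
    then obtain y where y: "y \<noteq> 0" "(transpose A ** A) *v y = s\<^sup>2 *\<^sub>R y"
      unfolding singular_value_def eigenvalue_def by blast
    have Ay: "A *v y \<noteq> 0"
      using y s by (auto simp: matrix_vector_mul_assoc[symmetric])
    have "?S *v (A *v y) = s\<^sup>2 *\<^sub>R (A *v y)"
      using y(2) by (metis matrix_vector_mul_assoc matrix_vector_mult_scaleR)
    then have "q * (norm (A *v y))\<^sup>2 \<le> s\<^sup>2 * (norm (A *v y))\<^sup>2"
      using ray[of "A *v y"] by (simp add: power2_norm_eq_inner)
    then have "q \<le> s\<^sup>2" using Ay by simp
    then show "sqrt q \<le> s" using s by (simp add: real_le_lsqrt)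
  qed
  then show ?thesis using ray[OF r] q by (simp add: quad)
qed simp

section \<open>One step of random descent\<close>

lemma rd_rank_one_mult:
  "rd_rank_one A x *v g = ((x \<bullet> g) / (norm (A *v x))\<^sup>2) *\<^sub>R x"
  by (simp add: vec_eq_iff rd_rank_one_def matrix_vector_mult_def inner_vec_def
      sum_divide_distrib sum_distrib_left algebra_simps)

lemma inner_rd_rank_one_nonneg: "0 \<le> g \<bullet> (rd_rank_one A x *v g)"
  by (simp add: rd_rank_one_mult inner_commute)

text \<open>Exact line search removes from the residual \<open>r\<close> its component along \<open>A *v x\<close>. By
  Pythagoras, the squared norm drops by the square of \<open>r \<bullet> (A *v x) / norm (A *v x)\<close>, which is
  the quadratic form of \<open>rd_rank_one A x\<close> at the gradient, because \<open>r \<bullet> (A *v x)\<close> equals the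
  inner product of the gradient with \<open>x\<close>.\<close>

lemma norm_residual_after_step:
  fixes A :: "real^'d^'m"
  defines "g \<equiv> \<lambda>v b. transpose A *v (A *v v - b)"
  shows "(norm (A *v (v + rd_stepsize A b v x *\<^sub>R x) - b))\<^sup>2
    = (norm (A *v v - b))\<^sup>2 - g v b \<bullet> (rd_rank_one A x *v g v b)"
proof (cases "A *v x = 0")
  case True
  then show ?thesis
    by (simp add: rd_stepsize_def rd_rank_one_mult)
next
  case False
  define r where "r = A *v v - b"
  define p where "p = A *v x"
  define t where "t = - (r \<bullet> p) / (p \<bullet> p)"
  have pp: "p \<bullet> p \<noteq> 0" using False by (simp add: p_def)
  have t: "rd_stepsize A b v x = t"
    using False by (simp add: rd_stepsize_def t_def r_def p_def power2_norm_eq_inner)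
  have gx: "g v b \<bullet> x = r \<bullet> p"
    unfolding g_def r_def p_def by (rule inner_transpose_mult_left)
  have "A *v (v + t *\<^sub>R x) - b = r + t *\<^sub>R p"
    by (simp add: r_def p_def matrix_vector_right_distrib matrix_vector_mult_scaleR)
  then have "(norm (A *v (v + t *\<^sub>R x) - b))\<^sup>2 = r \<bullet> r + t * (2 * (r \<bullet> p) + t * (p \<bullet> p))"
    by (simp add: power2_norm_eq_inner inner_add_left inner_add_right inner_commute
        algebra_simps)
  also have "\<dots> = r \<bullet> r - (r \<bullet> p)\<^sup>2 / (p \<bullet> p)"
    using pp by (simp add: t_def field_simps power2_eq_square)
  also have "\<dots> = (norm r)\<^sup>2 - g v b \<bullet> (rd_rank_one A x *v g v b)"
    using gx by (simp add: rd_rank_one_mult power2_norm_eq_inner p_def[symmetric]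
        inner_commute power2_eq_square[of "p \<bullet> r"])
  finally show ?thesis by (simp add: t r_def)
qed

lemma norm_residual_le:
  "(norm (A *v rd_iter A b xs k - b))\<^sup>2 \<le> (norm b)\<^sup>2"
proof (induction k)
  case (Suc k)
  have "(norm (A *v rd_iter A b xs (Suc k) - b))\<^sup>2 \<le> (norm (A *v rd_iter A b xs k - b))\<^sup>2"
    using inner_rd_rank_one_nonneg[of "transpose A *v (A *v rd_iter A b xs k - b)" A "xs k"]
    by (simp add: norm_residual_after_step)
  with Suc show ?case by linarith
qed simp

lemma rd_iter_cong:
  "(\<And>i. i < k \<Longrightarrow> xs i = ys i) \<Longrightarrow> rd_iter A b xs k = rd_iter A b ys k"
  by (induction k) auto

lemma borel_measurable_matrix_vector_mult [measurable]:
  fixes A :: "real^'d^'m"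
  shows "(\<lambda>x. A *v x) \<in> borel_measurable borel"
  by (intro borel_measurable_continuous_onI linear_continuous_on matrix_vector_mul_bounded_linear)

lemma borel_measurable_vec_nth [measurable]:
  "(\<lambda>x::real^'d. x $ i) \<in> borel_measurable borel"
  by (intro borel_measurable_continuous_onI continuous_intros)

lemma borel_measurable_rd_stepsize [measurable]:
  assumes [measurable]: "f \<in> borel_measurable N" "h \<in> borel_measurable N"
  shows "(\<lambda>w. rd_stepsize A b (f w) (h w)) \<in> borel_measurable N"
proof -
  have [measurable]: "(\<lambda>w. A *v f w) \<in> borel_measurable N" "(\<lambda>w. A *v h w) \<in> borel_measurable N"
    by measurable
  show ?thesis unfolding rd_stepsize_def by measurable
qed

text \<open>Only the first \<open>k\<close> directions enter the iterate, but in order to run the induction on \<open>k\<close>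
  the index set of the product space has to stay fixed, at some \<open>j \<ge> k\<close>.\<close>

lemma borel_measurable_rd_iter:
  "k \<le> j \<Longrightarrow> (\<lambda>xs. rd_iter A b xs k) \<in> borel_measurable (PiM {..<j} (\<lambda>_. borel))"
proof (induction k)
  case (Suc k)
  then have [measurable]: "(\<lambda>xs. rd_iter A b xs k) \<in> borel_measurable (PiM {..<j} (\<lambda>_. borel))"
    and [measurable]: "(\<lambda>xs. xs k) \<in> borel_measurable (PiM {..<j} (\<lambda>_. borel))"
    by auto
  show ?case by simp
qed simp

section \<open>Expectations of quadratic forms\<close>

lemma bounded_linear_quadratic_form:
  fixes g :: "real^'d"
  shows "bounded_linear (\<lambda>R::real^'d^'d. g \<bullet> (R *v g))"
  by (intro linear_conv_bounded_linear[THEN iffD1] linearI)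
    (simp_all add: matrix_vector_mult_add_rdistrib inner_add_right
      scaleR_matrix_vector_assoc[symmetric])

lemma quadratic_form_as_sum:
  fixes g :: "real^'d"
  shows "g \<bullet> (R *v g) = (\<Sum>i\<in>UNIV. \<Sum>j\<in>UNIV. (g $ i * g $ j) * R $ i $ j)"
  by (simp add: inner_vec_def matrix_vector_mult_def sum_distrib_left algebra_simps)

lemma bounded_linear_entry: "bounded_linear (\<lambda>R::real^'d^'d. R $ i $ j)"
  by (rule bounded_linear_compose[OF bounded_linear_vec_nth bounded_linear_vec_nth])

lemma borel_measurable_entry: "(\<lambda>R::real^'d^'d. R $ i $ j) \<in> borel_measurable borel"
  by (intro borel_measurable_continuous_onI linear_continuous_on bounded_linear_entry)

locale random_descent = prob_space P
  for P :: "'a measure" +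
  fixes A :: "real^'d^'m" and b :: "real^'m" and D :: "(real^'d) measure"
    and X :: "nat \<Rightarrow> 'a \<Rightarrow> real^'d" and M :: "real^'d^'d"
  assumes indep: "indep_vars (\<lambda>_. borel) X UNIV"
    and distr: "\<And>k. distr P borel (X k) = D"
    and integrable_rank_one: "integrable D (rd_rank_one A)"
    and M: "M = rd_matrix A D"
begin

definition v :: "nat \<Rightarrow> 'a \<Rightarrow> real^'d" where
  "v k \<omega> = rd_iter A b (\<lambda>i. X i \<omega>) k"

definition residual :: "nat \<Rightarrow> 'a \<Rightarrow> real^'m" where
  "residual k \<omega> = A *v v k \<omega> - b"

definition gradient :: "nat \<Rightarrow> 'a \<Rightarrow> real^'d" where
  "gradient k \<omega> = transpose A *v residual k \<omega>"

lemma measurable_direction [measurable]: "X k \<in> borel_measurable P"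
  using indep by (simp add: indep_vars_def)

lemma prob_space_D: "prob_space D"
  using prob_space_distr[OF measurable_direction] distr by metis

lemma sets_D [measurable_cong]: "sets D = sets borel"
  using distr[of 0] by auto

lemma borel_measurable_rank_one [measurable]: "rd_rank_one A \<in> borel_measurable borel"
  using borel_measurable_integrable[OF integrable_rank_one] measurable_cong_sets[OF sets_D refl]
  by blast

lemma M_entry: "M $ i $ j = (LINT x|D. rd_rank_one A x $ i $ j)"
  unfolding M rd_matrix_def
  by (rule integral_bounded_linear[OF bounded_linear_entry integrable_rank_one, symmetric])

lemma M_quadratic_form: "g \<bullet> (M *v g) = (LINT x|D. g \<bullet> (rd_rank_one A x *v g))"
  unfolding M rd_matrix_def
  by (rule integral_bounded_linear[OF bounded_linear_quadratic_form integrable_rank_one, symmetric])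

lemma M_symmetric: "transpose M = M"
proof -
  have "rd_rank_one A x $ i $ j = rd_rank_one A x $ j $ i" for x i j
    by (simp add: rd_rank_one_def mult.commute)
  then show ?thesis
    by (simp add: vec_eq_iff transpose_def M_entry)
qed

lemma M_nonneg: "0 \<le> g \<bullet> (M *v g)"
  unfolding M_quadratic_form by (rule Bochner_Integration.integral_nonneg) (rule inner_rd_rank_one_nonneg)

text \<open>Averaging the one-step identity over the direction alone; linearity of the quadratic form
  in the matrix turns the averaged rank-one matrices into \<open>M\<close>.\<close>

lemma expected_residual_over_direction:
  fixes u :: "real^'d"
  defines "g \<equiv> transpose A *v (A *v u - b)"
  shows "(LINT x|D. (norm (A *v (u + rd_stepsize A b u x *\<^sub>R x) - b))\<^sup>2)
    = (norm (A *v u - b))\<^sup>2 - g \<bullet> (M *v g)"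
proof -
  interpret D: prob_space D by (rule prob_space_D)
  have int: "integrable D (\<lambda>x. g \<bullet> (rd_rank_one A x *v g))"
    by (rule integrable_bounded_linear[OF bounded_linear_quadratic_form integrable_rank_one])
  have "(LINT x|D. (norm (A *v (u + rd_stepsize A b u x *\<^sub>R x) - b))\<^sup>2)
      = (LINT x|D. (norm (A *v u - b))\<^sup>2 - g \<bullet> (rd_rank_one A x *v g))"
    unfolding g_def by (simp only: norm_residual_after_step)
  also have "\<dots> = (norm (A *v u - b))\<^sup>2 - g \<bullet> (M *v g)"
    using int by (simp add: M_quadratic_form D.prob_space)
  finally show ?thesis .
qed

text \<open>The \<open>k\<close>th iterate is a function of the first \<open>k\<close> directions, hence independent of the
  direction that is drawn next.\<close>

lemma indep_iterate_direction:
  assumes "f \<in> borel_measurable borel" "h \<in> borel_measurable borel"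
  shows "indep_var borel (\<lambda>\<omega>. f (v k \<omega>)) borel (\<lambda>\<omega>. h (X k \<omega>))"
proof -
  have "indep_var borel ((\<lambda>xs. f (rd_iter A b xs k)) \<circ> (\<lambda>\<omega>. restrict (\<lambda>i. X i \<omega>) {..<k}))
      borel ((\<lambda>xs. h (xs k)) \<circ> (\<lambda>\<omega>. restrict (\<lambda>i. X i \<omega>) {k}))"
  proof (rule indep_var_compose[OF indep_var_restrict[OF indep]])
    show "(\<lambda>xs. f (rd_iter A b xs k)) \<in> borel_measurable (PiM {..<k} (\<lambda>_. borel))"
      by (rule measurable_compose[OF borel_measurable_rd_iter assms(1)]) simp
    show "(\<lambda>xs. h (xs k)) \<in> borel_measurable (PiM {k} (\<lambda>_. borel))"
      by (rule measurable_compose[OF _ assms(2)]) simp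
  qed auto
  moreover have "rd_iter A b (restrict (\<lambda>i. X i \<omega>) {..<k}) k = v k \<omega>" for \<omega>
    unfolding v_def by (rule rd_iter_cong) simp
  ultimately show ?thesis by (simp add: comp_def)
qed

lemma measurable_iterate [measurable]: "v k \<in> borel_measurable P"
  using indep_var_rv1[OF indep_iterate_direction[of "\<lambda>x. x" "\<lambda>x. x"]] by simp

lemma measurable_residual [measurable]: "residual k \<in> borel_measurable P"
  unfolding residual_def by measurable

lemma measurable_gradient [measurable]: "gradient k \<in> borel_measurable P"
  unfolding gradient_def by measurable

lemma residual_bound: "(norm (residual k \<omega>))\<^sup>2 \<le> (norm b)\<^sup>2"
  unfolding residual_def v_def by (rule norm_residual_le)

lemma integrable_residual: "integrable P (\<lambda>\<omega>. (norm (residual k \<omega>))\<^sup>2)"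
  by (rule integrable_const_bound[where B = "(norm b)\<^sup>2"]) (auto simp: residual_bound)

lemma gradient_bounded: "\<exists>C. \<forall>k \<omega>. norm (gradient k \<omega>) \<le> C"
proof -
  obtain K where K: "K > 0" "\<And>x. norm (transpose A *v x) \<le> norm x * K"
    using bounded_linear.pos_bounded[OF matrix_vector_mul_bounded_linear[of "transpose A"]] by blast
  have "norm (residual k \<omega>) \<le> norm b" for k \<omega>
    using residual_bound[of k \<omega>] by (rule power2_le_imp_le) simp
  then have "norm (gradient k \<omega>) \<le> norm b * K" for k \<omega>
    unfolding gradient_def using K by (meson mult_right_mono order_trans less_imp_le)
  then show ?thesis by blast
qed

lemma integrable_gradient_entries: "integrable P (\<lambda>\<omega>. gradient k \<omega> $ i * gradient k \<omega> $ j)"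
proof -
  obtain C where C: "\<And>k \<omega>. norm (gradient k \<omega>) \<le> C" using gradient_bounded by blast
  have entry: "\<bar>gradient k \<omega> $ i\<bar> \<le> C" for \<omega> i
    by (rule order_trans[OF component_le_norm_cart C])
  have "\<bar>gradient k \<omega> $ i * gradient k \<omega> $ j\<bar> \<le> C * C" for \<omega>
    unfolding abs_mult using entry[of \<omega> i] entry[of \<omega> j] by (intro mult_mono) auto
  moreover have "(\<lambda>\<omega>. gradient k \<omega> $ i) \<in> borel_measurable P" for i
    by measurable
  ultimately show ?thesis
    by (intro integrable_const_bound[where B = "C * C"]) auto
qed

lemma integrable_gradient_norm: "integrable P (\<lambda>\<omega>. (norm (gradient k \<omega>))\<^sup>2)"
  unfolding power2_norm_eq_inner inner_vec_def
  using integrable_gradient_entries by (intro Bochner_Integration.integrable_sum) simp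

lemma integrable_M_gradient: "integrable P (\<lambda>\<omega>. gradient k \<omega> \<bullet> (M *v gradient k \<omega>))"
  unfolding quadratic_form_as_sum
  by (rule Bochner_Integration.integrable_sum, rule Bochner_Integration.integrable_sum)
    (rule integrable_mult_left, rule integrable_gradient_entries)

text \<open>Each entry of the fresh rank-one matrix is independent of the products of gradient entries
  by which it is multiplied in the quadratic form; so its expectation may be taken separately.
  Summing over the entries reassembles the quadratic form of \<open>M\<close>.\<close>

lemma expectation_gradient_rank_one:
  "expectation (\<lambda>\<omega>. gradient k \<omega> \<bullet> (rd_rank_one A (X k \<omega>) *v gradient k \<omega>))
    = expectation (\<lambda>\<omega>. gradient k \<omega> \<bullet> (M *v gradient k \<omega>))" (is ?exp)
  and integrable_gradient_rank_one:
  "integrable P (\<lambda>\<omega>. gradient k \<omega> \<bullet> (rd_rank_one A (X k \<omega>) *v gradient k \<omega>))" (is ?int)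
proof -
  let ?G = "\<lambda>i j \<omega>. gradient k \<omega> $ i * gradient k \<omega> $ j"
  let ?R = "\<lambda>i j \<omega>. rd_rank_one A (X k \<omega>) $ i $ j"
  have meas: "(\<lambda>x. rd_rank_one A x $ i $ j) \<in> borel_measurable borel" for i j
    by (rule measurable_compose[OF borel_measurable_rank_one borel_measurable_entry])
  have measG: "(\<lambda>u. (transpose A *v (A *v u - b)) $ i * (transpose A *v (A *v u - b)) $ j)
      \<in> borel_measurable borel" for i j
    by measurable
  have "integrable (distr P borel (X k)) (\<lambda>x. rd_rank_one A x $ i $ j)" for i j
    unfolding distr by (rule integrable_bounded_linear[OF bounded_linear_entry integrable_rank_one])
  then have intR: "integrable P (?R i j)" for i j
    by (subst (asm) integrable_distr_eq[OF measurable_direction meas])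
  have expR: "expectation (?R i j) = M $ i $ j" for i j
    unfolding M_entry distr[of k, symmetric]
    by (rule integral_distr[OF measurable_direction meas, symmetric])
  have ind: "indep_var borel (?G i j) borel (?R i j)" for i j
    using indep_iterate_direction[OF measG meas] unfolding gradient_def residual_def .
  have int: "integrable P (\<lambda>\<omega>. ?G i j \<omega> * ?R i j \<omega>)" for i j
    by (rule indep_var_integrable[OF ind integrable_gradient_entries intR])
  have exp: "expectation (\<lambda>\<omega>. ?G i j \<omega> * ?R i j \<omega>) = expectation (\<lambda>\<omega>. ?G i j \<omega> * M $ i $ j)" for i j
    using indep_var_lebesgue_integral[OF ind integrable_gradient_entries intR]
    by (simp add: expR)
  show ?int
    unfolding quadratic_form_as_sum by (intro Bochner_Integration.integrable_sum int)
  show ?exp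
    unfolding quadratic_form_as_sum
    by (simp add: Bochner_Integration.integral_sum int exp integrable_gradient_entries
        del: integral_mult_left_zero integral_mult_left)
qed

lemma expectation_residual_Suc:
  "expectation (\<lambda>\<omega>. (norm (residual (Suc k) \<omega>))\<^sup>2)
    = expectation (\<lambda>\<omega>. (norm (residual k \<omega>))\<^sup>2)
      - expectation (\<lambda>\<omega>. gradient k \<omega> \<bullet> (M *v gradient k \<omega>))"
proof -
  have "(norm (residual (Suc k) \<omega>))\<^sup>2 = (norm (residual k \<omega>))\<^sup>2
      - gradient k \<omega> \<bullet> (rd_rank_one A (X k \<omega>) *v gradient k \<omega>)" for \<omega>
    by (simp add: residual_def gradient_def v_def norm_residual_after_step)
  then show ?thesis
    by (simp add: integrable_residual integrable_gradient_rank_one expectation_gradient_rank_one)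
qed

text \<open>Any lower bound of the decrease by a multiple of the squared residual yields a contraction
  of the expected squared residual; both linear rates are instances.\<close>

lemma expectation_residual_contraction:
  assumes "\<And>\<omega>. c * (norm (residual k \<omega>))\<^sup>2 \<le> gradient k \<omega> \<bullet> (M *v gradient k \<omega>)"
  shows "expectation (\<lambda>\<omega>. (norm (residual (Suc k) \<omega>))\<^sup>2)
    \<le> (1 - c) * expectation (\<lambda>\<omega>. (norm (residual k \<omega>))\<^sup>2)"
proof -
  have "c * expectation (\<lambda>\<omega>. (norm (residual k \<omega>))\<^sup>2)
      = expectation (\<lambda>\<omega>. c * (norm (residual k \<omega>))\<^sup>2)" by simp
  also have "\<dots> \<le> expectation (\<lambda>\<omega>. gradient k \<omega> \<bullet> (M *v gradient k \<omega>))"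
    by (intro integral_mono integrable_mult_right integrable_residual integrable_M_gradient assms)
  finally show ?thesis
    unfolding expectation_residual_Suc by (simp add: algebra_simps)
qed

lemma contraction_sigma_min:
  assumes b: "b \<in> range (\<lambda>u. A *v u)"
  shows "expectation (\<lambda>\<omega>. (norm (residual (Suc k) \<omega>))\<^sup>2)
    \<le> (1 - lambda_min M * (sigma_min A)\<^sup>2) * expectation (\<lambda>\<omega>. (norm (residual k \<omega>))\<^sup>2)"
proof (rule expectation_residual_contraction)
  fix \<omega>
  obtain u where u: "b = A *v u" using b by blast
  have "residual k \<omega> = A *v (v k \<omega> - u)"
    unfolding residual_def matrix_vector_mult_diff_distrib by (simp flip: u)
  then have "(sigma_min A)\<^sup>2 * (norm (residual k \<omega>))\<^sup>2 \<le> (norm (gradient k \<omega>))\<^sup>2"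
    unfolding gradient_def by (intro sigma_min_le_norm_transpose_on_range) auto
  then have "lambda_min M * ((sigma_min A)\<^sup>2 * (norm (residual k \<omega>))\<^sup>2)
      \<le> lambda_min M * (norm (gradient k \<omega>))\<^sup>2"
    by (intro mult_left_mono lambda_min_nonneg M_symmetric M_nonneg)
  also have "\<dots> \<le> gradient k \<omega> \<bullet> (M *v gradient k \<omega>)"
    by (rule lambda_min_le_rayleigh[OF M_symmetric])
  finally show "lambda_min M * (sigma_min A)\<^sup>2 * (norm (residual k \<omega>))\<^sup>2
      \<le> gradient k \<omega> \<bullet> (M *v gradient k \<omega>)" by (simp add: mult.assoc)
qed

lemma contraction_lambda_min:
  "expectation (\<lambda>\<omega>. (norm (residual (Suc k) \<omega>))\<^sup>2)
    \<le> (1 - lambda_min (A ** M ** transpose A)) * expectation (\<lambda>\<omega>. (norm (residual k \<omega>))\<^sup>2)"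
proof (rule expectation_residual_contraction)
  fix \<omega>
  have "transpose (A ** M ** transpose A) = A ** M ** transpose A"
    by (simp add: matrix_transpose_mul M_symmetric matrix_mul_assoc)
  from lambda_min_le_rayleigh[OF this, of "residual k \<omega>"]
  show "lambda_min (A ** M ** transpose A) * (norm (residual k \<omega>))\<^sup>2
      \<le> gradient k \<omega> \<bullet> (M *v gradient k \<omega>)"
    by (simp add: gradient_def inner_transpose_mult_left matrix_vector_mul_assoc[symmetric])
qed

text \<open>The decreases in the first \<open>N\<close> steps telescope to at most the initial value \<open>(norm b)\<^sup>2\<close>.\<close>

lemma sum_expectation_gradient_le:
  "lambda_min M * (\<Sum>k<N. expectation (\<lambda>\<omega>. (norm (gradient k \<omega>))\<^sup>2)) \<le> (norm b)\<^sup>2"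
proof -
  let ?E = "\<lambda>k. expectation (\<lambda>\<omega>. (norm (residual k \<omega>))\<^sup>2)"
  have step: "lambda_min M * expectation (\<lambda>\<omega>. (norm (gradient k \<omega>))\<^sup>2) \<le> ?E k - ?E (Suc k)" for k
  proof -
    have "expectation (\<lambda>\<omega>. lambda_min M * (norm (gradient k \<omega>))\<^sup>2)
        \<le> expectation (\<lambda>\<omega>. gradient k \<omega> \<bullet> (M *v gradient k \<omega>))"
      by (intro integral_mono integrable_mult_right integrable_gradient_norm integrable_M_gradient
          lambda_min_le_rayleigh M_symmetric)
    then show ?thesis unfolding expectation_residual_Suc by simp
  qed
  have "lambda_min M * (\<Sum>k<N. expectation (\<lambda>\<omega>. (norm (gradient k \<omega>))\<^sup>2)) \<le> (\<Sum>k<N. ?E k - ?E (Suc k))"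
    unfolding sum_distrib_left by (intro sum_mono step)
  also have "\<dots> = ?E 0 - ?E N" by (rule sum_lessThan_telescope')
  also have "\<dots> \<le> ?E 0" by simp
  also have "?E 0 = (norm b)\<^sup>2" by (simp add: residual_def v_def prob_space)
  finally show ?thesis .
qed

lemma min_expectation_gradient_le:
  assumes lam: "lambda_min M > 0" and N: "N \<ge> 1"
  shows "(MIN k\<in>{0..N-1}. expectation (\<lambda>\<omega>. (norm (gradient k \<omega>))\<^sup>2))
    \<le> (norm b)\<^sup>2 / (lambda_min M * real N)"
proof -
  let ?G = "\<lambda>k. expectation (\<lambda>\<omega>. (norm (gradient k \<omega>))\<^sup>2)"
  let ?m = "MIN k\<in>{0..N-1}. ?G k"
  have "real N * ?m = (\<Sum>k<N. ?m)" by simp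
  also have "\<dots> \<le> (\<Sum>k<N. ?G k)"
    by (intro sum_mono Min_le) auto
  finally have "lambda_min M * (real N * ?m) \<le> lambda_min M * (\<Sum>k<N. ?G k)"
    using lam by (intro mult_left_mono) auto
  with sum_expectation_gradient_le[of N] have "?m * (lambda_min M * real N) \<le> (norm b)\<^sup>2"
    by (simp add: algebra_simps)
  then show ?thesis using lam N by (simp add: pos_le_divide_eq)
qed

end

section \<open>Convergence of random descent\<close>

theorem theorem3p13:
  fixes A :: "real^'d^'m" and b :: "real^'m"
    and P :: "'a measure" and D :: "(real^'d) measure"
    and X :: "nat \<Rightarrow> 'a \<Rightarrow> real^'d" and v :: "nat \<Rightarrow> 'a \<Rightarrow> real^'d" and M :: "real^'d^'d"
  assumes "prob_space P"
    and "prob_space.indep_vars P (\<lambda>_. borel) X UNIV"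
    and "\<And>k. distr P borel (X k) = D"
    and "\<And>k \<omega>. v k \<omega> = rd_iter A b (\<lambda>i. X i \<omega>) k"
    and "integrable D (rd_rank_one A)"
    and "M = rd_matrix A D"
  shows
    "(\<forall>k. \<forall>\<omega>\<in>space P.
        (LINT x|D. (norm (A *v rd_iter A b ((\<lambda>i. X i \<omega>)(k := x)) (Suc k) - b))\<^sup>2)
          = (norm (A *v v k \<omega> - b))\<^sup>2
            - (transpose A *v (A *v v k \<omega> - b)) \<bullet> (M *v (transpose A *v (A *v v k \<omega> - b))))
     \<and> (lambda_min M > 0 \<longrightarrow>
         (\<forall>N\<ge>1. (MIN k\<in>{0..N-1}. LINT \<omega>|P. (norm (transpose A *v (A *v v k \<omega> - b)))\<^sup>2)
                   \<le> (norm b)\<^sup>2 / (lambda_min M * real N)))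
     \<and> (b \<in> range (\<lambda>u. A *v u) \<longrightarrow>
         (\<forall>k. (LINT \<omega>|P. (norm (A *v v (Suc k) \<omega> - b))\<^sup>2)
                \<le> (1 - lambda_min M * (sigma_min A)\<^sup>2) * (LINT \<omega>|P. (norm (A *v v k \<omega> - b))\<^sup>2)))
     \<and> (\<forall>k. (LINT \<omega>|P. (norm (A *v v (Suc k) \<omega> - b))\<^sup>2)
              \<le> (1 - lambda_min (A ** M ** transpose A)) * (LINT \<omega>|P. (norm (A *v v k \<omega> - b))\<^sup>2))"
proof -
  interpret R: random_descent P A b D X M
    by (rule random_descent.intro[OF assms(1) random_descent_axioms.intro[OF assms(2,3,5,6)]])
  have v: "v = R.v" by (intro ext) (simp add: assms(4) R.v_def)
  have step: "rd_iter A b ((\<lambda>i. X i \<omega>)(k := x)) (Suc k)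
      = R.v k \<omega> + rd_stepsize A b (R.v k \<omega>) x *\<^sub>R x" for k x \<omega>
  proof -
    have "rd_iter A b ((\<lambda>i. X i \<omega>)(k := x)) k = R.v k \<omega>"
      unfolding R.v_def by (rule rd_iter_cong) simp
    then show ?thesis by simp
  qed
  show ?thesis
    unfolding v step
    using R.expected_residual_over_direction
      R.min_expectation_gradient_le[unfolded R.gradient_def R.residual_def]
      R.contraction_sigma_min[unfolded R.residual_def]
      R.contraction_lambda_min[unfolded R.residual_def]
    by (intro conjI allI ballI impI) simp_all
qed

end
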